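(* Let $\psi:\mathbb{S}^{n}_{++}\to\mathbb{R}$ be a mirror map and let $X,Y\in\mathbb{S}^{n}_{++}$ be fixed. Consider the problem of minimizing, over all means $M\in\mathcal{M}$, the forward symmetrized Bregman divergence $$D_{\psi}^{\overrightarrow{\mathrm{symm}}}(X,Y;M)=\frac{1}{2}\Big\{D_{\psi}\big(X, M(X,Y)\big)+D_{\psi}\big(Y, M(X,Y)\big)\Big\}.$$ Then the minimum over $\mathcal{M}$ is attained, and the unique minimizer (as a matrix, i.e. the value $M(X,Y)$ at the given pair $X,Y$) is $$\overrightarrow{M}_{\mathrm{canonical}}=\frac{X+Y}{2}.$$
   Context: $\mathbb{S}^{n}$ is the set of real symmetric $n\times n$ matrices, $\mathbb{S}^{n}_{++}\subset\mathbb{S}^n$ is the open convex cone of positive definite ones, $\langle A,B\rangle=\mathrm{trace}(AB)$ is the Frobenius inner product on $\mathbb{S}^n$, $\preceq$ is the Löwner partial order, and $\mathrm{GL}(n)$ is the group of invertible real $n\times n$ matrices. Mirror map: a function $\psi:\mathbb{S}^{n}_{++}\to\mathbb{R}$ of Legendre type, meaning that $\psi$ is closed, proper, strictly convex and twice continuously differentiable on $\mathbb{S}^{n}_{++}$, that its gradient $\nabla\psi$ (with respect to $\langle\cdot,\cdot\rangle$) is a diffeomorphism from $\mathbb{S}^{n}_{++}$ onto its range in $\mathbb{S}^n$, and that $\|\nabla\psi(X)\|_2\to\infty$ as $X$ tends to the boundary of the closure of $\mathbb{S}^{n}_{++}$. Bregman divergence induced by $\psi$: $D_{\psi}(X,Y):=\psi(X)-\{\psi(Y)+\langle\nabla\psi(Y),X-Y\rangle\}$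 for $X,Y\in\mathbb{S}^{n}_{++}$ (also written $D_\psi(X\parallel Y)$). Mean on $\mathbb{S}^{n}_{++}$: a map $M:\mathbb{S}^{n}_{++}\times\mathbb{S}^{n}_{++}\to\mathbb{S}^{n}_{++}$ such that for all $A,B\in\mathbb{S}^{n}_{++}$: (i) $M(A,B)\succ0$; (ii) $M(A,B)=M(B,A)$; (iii) $A\preceq B$ implies $A\preceq M(A,B)\preceq B$; (iv) $M(A,B)$ is operator monotone increasing in $A$ and in $B$ (i.e. nondecreasing for $\preceq$ in each argument); (v) $M(P^{\top}AP,P^{\top}BP)=P^{\top}M(A,B)P$ for all $P\in\mathrm{GL}(n)$; (vi) $M(A,B)$ is continuous in $A,B$. $\mathcal{M}$ denotes the set of all means on $\mathbb{S}^{n}_{++}$. For fixed $X,Y$, the objective depends on $M$ only through the matrix $M(X,Y)$, and $\overrightarrow{M}_{\mathrm{canonical}}:=\arg\min_{M\in\mathcal{M}}D_{\psi}^{\overrightarrow{\mathrm{symm}}}(X,Y;M)$ is identified with this matrix. *)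

theory Defs
  imports "HOL-Analysis.Analysis"
begin

text \<open>The space of real symmetric matrices is the subspace \<open>sym_mats\<close> of \<open>real ^ 'n ^ 'n\<close>, with the
  subspace topology \<open>top_of_set sym_mats\<close>. It is closed, so \<open>closure\<close> is the same in both spaces.\<close>

type_synonym 'n sqmat = "real ^ 'n ^ 'n"

definition sym_mats :: "'n::finite sqmat set" where
  "sym_mats = {A. transpose A = A}"

definition possemidef :: "'n::finite sqmat set" where
  "possemidef = {A \<in> sym_mats. \<forall>x. 0 \<le> x \<bullet> (A *v x)}"

definition posdef :: "'n::finite sqmat set" where
  "posdef = {A \<in> sym_mats. \<forall>x. x \<noteq> 0 \<longrightarrow> 0 < x \<bullet> (A *v x)}"

definition loewner_le :: "'n::finite sqmat \<Rightarrow> 'n sqmat \<Rightarrow> bool"  (infix \<open>\<preceq>\<^sub>L\<close> 50) where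
  "A \<preceq>\<^sub>L B \<longleftrightarrow> B - A \<in> possemidef"

definition frob_inner :: "'n::finite sqmat \<Rightarrow> 'n sqmat \<Rightarrow> real" where
  "frob_inner A B = trace (A ** B)"

subsection \<open>Convex functions\<close>

definition strictly_convex_on :: "'a::real_vector set \<Rightarrow> ('a \<Rightarrow> real) \<Rightarrow> bool" where
  "strictly_convex_on S f \<longleftrightarrow> convex S \<and>
     (\<forall>x\<in>S. \<forall>y\<in>S. \<forall>t\<in>{0<..<1}. x \<noteq> y \<longrightarrow>
        f ((1 - t) *\<^sub>R x + t *\<^sub>R y) < (1 - t) * f x + t * f y)"

definition ext_epigraph :: "('a \<Rightarrow> ereal) \<Rightarrow> ('a \<times> real) set" where
  "ext_epigraph F = {(x, t). F x \<le> ereal t}"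

definition eff_domain :: "('a \<Rightarrow> ereal) \<Rightarrow> 'a set" where
  "eff_domain F = {x. F x < \<infinity>}"

definition closed_proper_convex :: "('a::real_normed_vector \<Rightarrow> ereal) \<Rightarrow> bool" where
  "closed_proper_convex F \<longleftrightarrow>
     closed (ext_epigraph F) \<and>
     eff_domain F \<noteq> {} \<and> (\<forall>x. F x \<noteq> -\<infinity>) \<and>
     convex (ext_epigraph F)"

subsection \<open>Differentiability\<close>

text \<open>Derivatives are taken within \<open>posdef\<close>, so that only symmetric directions matter. The ambient
  linear map representing such a derivative is then determined only on \<open>sym_mats\<close>; requiring the
  gradient to be symmetric makes it unique.\<close>

definition gradient :: "('n::finite sqmat \<Rightarrow> real) \<Rightarrow> 'n sqmat \<Rightarrow> 'n sqmat" where
  "gradient \<psi> X = (THE G. G \<in> sym_mats \<and>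
     (\<psi> has_derivative (\<lambda>H. frob_inner G H)) (at X within posdef))"

definition C1_on :: "'a::real_normed_vector set \<Rightarrow> ('a \<Rightarrow> 'b::real_normed_vector) \<Rightarrow> bool" where
  "C1_on S f \<longleftrightarrow> (\<exists>D. (\<forall>x\<in>S. (f has_derivative blinfun_apply (D x)) (at x within S)) \<and>
                       continuous_on S D)"

text \<open>Diffeomorphism between relatively open subsets of \<open>sym_mats\<close>.\<close>

definition sym_diffeomorphism ::
    "'n::finite sqmat set \<Rightarrow> 'n sqmat set \<Rightarrow> ('n sqmat \<Rightarrow> 'n sqmat) \<Rightarrow> bool" where
  "sym_diffeomorphism S T f \<longleftrightarrow>
     openin (top_of_set sym_mats) S \<and> openin (top_of_set sym_mats) T \<and>
     bij_betw f S T \<and> C1_on S f \<and> C1_on T (inv_into S f)"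

subsection \<open>Mirror maps and Bregman divergences\<close>

text \<open>As usual for functions of Legendre type, ``closed, proper'' refers to an extended-valued convex
  function whose effective domain has interior \<open>posdef\<close> and which agrees with \<open>\<psi>\<close> there. Its domain
  may contain boundary points, as for the von Neumann entropy \<open>tr (X log X - X)\<close>.\<close>

definition mirror_map :: "('n::finite sqmat \<Rightarrow> real) \<Rightarrow> bool" where
  "mirror_map \<psi> \<longleftrightarrow>
     (\<exists>F. closed_proper_convex F \<and>
          eff_domain F \<subseteq> sym_mats \<and>
          (top_of_set sym_mats) interior_of (eff_domain F) = posdef \<and>
          (\<forall>X\<in>posdef. F X = ereal (\<psi> X))) \<and>
     strictly_convex_on posdef \<psi> \<and>
     (\<forall>X\<in>posdef. \<psi> differentiable (at X within posdef)) \<and>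
     C1_on posdef (gradient \<psi>) \<and>
     sym_diffeomorphism posdef (gradient \<psi> ` posdef) (gradient \<psi>) \<and>
     (\<forall>Z \<in> (top_of_set sym_mats) frontier_of (closure posdef).
        filterlim (\<lambda>X. norm (gradient \<psi> X)) at_top (at Z within posdef))"

definition bregman :: "('n::finite sqmat \<Rightarrow> real) \<Rightarrow> 'n sqmat \<Rightarrow> 'n sqmat \<Rightarrow> real" where
  "bregman \<psi> X Y = \<psi> X - (\<psi> Y + frob_inner (gradient \<psi> Y) (X - Y))"

subsection \<open>Means\<close>

text \<open>A mean is represented by a total function of which only the values on \<open>posdef\<close> are
  constrained.\<close>

definition means :: "('n::finite sqmat \<Rightarrow> 'n sqmat \<Rightarrow> 'n sqmat) set" where
  "means = {M.
     (\<forall>A\<in>posdef. \<forall>B\<in>posdef. M A B \<in> posdef) \<and>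
     (\<forall>A\<in>posdef. \<forall>B\<in>posdef. M A B = M B A) \<and>
     (\<forall>A\<in>posdef. \<forall>B\<in>posdef. A \<preceq>\<^sub>L B \<longrightarrow> A \<preceq>\<^sub>L M A B \<and> M A B \<preceq>\<^sub>L B) \<and>
     (\<forall>A\<in>posdef. \<forall>A'\<in>posdef. \<forall>B\<in>posdef. A \<preceq>\<^sub>L A' \<longrightarrow> M A B \<preceq>\<^sub>L M A' B) \<and>
     (\<forall>A\<in>posdef. \<forall>B\<in>posdef. \<forall>B'\<in>posdef. B \<preceq>\<^sub>L B' \<longrightarrow> M A B \<preceq>\<^sub>L M A B') \<and>
     (\<forall>A\<in>posdef. \<forall>B\<in>posdef. \<forall>P. invertible P \<longrightarrow>
        M (transpose P ** A ** P) (transpose P ** B ** P) = transpose P ** M A B ** P) \<and>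
     continuous_on (posdef \<times> posdef) (\<lambda>(A, B). M A B)}"

definition forward_symm_bregman ::
    "('n::finite sqmat \<Rightarrow> real) \<Rightarrow> 'n sqmat \<Rightarrow> 'n sqmat \<Rightarrow> ('n sqmat \<Rightarrow> 'n sqmat \<Rightarrow> 'n sqmat) \<Rightarrow> real"
  where
  "forward_symm_bregman \<psi> X Y M = 1 / 2 * (bregman \<psi> X (M X Y) + bregman \<psi> Y (M X Y))"

definition forward_minimizer ::
    "('n::finite sqmat \<Rightarrow> real) \<Rightarrow> 'n sqmat \<Rightarrow> 'n sqmat \<Rightarrow> ('n sqmat \<Rightarrow> 'n sqmat \<Rightarrow> 'n sqmat) \<Rightarrow> bool"
  where
  "forward_minimizer \<psi> X Y M \<longleftrightarrow>
     is_arg_min (forward_symm_bregman \<psi> X Y) (\<lambda>N. N \<in> means) M"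

end

theory Submission
  imports Defs
begin

text \<open>With \<open>B = (X + Y) / 2\<close>, the gradient term of the objective is linear in the first argument, so
  the objective at \<open>Z = M X Y\<close> exceeds the objective at \<open>B\<close> by exactly \<open>bregman \<psi> B Z\<close>, which by
  strict convexity is positive unless \<open>Z = B\<close>. The arithmetic mean is itself a mean, so the value
  \<open>B\<close> is attained.\<close>

text \<open>Along a segment from \<open>z\<close>, strict convexity bounds every difference quotient
  by the slope of the chord. Passing to the limit gives only the weak tangent inequality
  \<open>weak\<close>; strictness is recovered afterwards at a midpoint.\<close>

lemma strictly_convex_on_above_tangent:
  assumes conv: "strictly_convex_on S f"
    and der: "(f has_derivative L) (at z within S)"
    and "z \<in> S" "b \<in> S" "b \<noteq> z"
  shows "f z + L (b - z) < f b"
proof -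
  have convS: "convex S" using conv by (simp add: strictly_convex_on_def)
  have chord: "f (z + t *\<^sub>R (y - z)) < f z + t * (f y - f z)"
    if "y \<in> S" "y \<noteq> z" "0 < t" "t < 1" for y t
  proof -
    have "f ((1 - t) *\<^sub>R z + t *\<^sub>R y) < (1 - t) * f z + t * f y"
      using conv that \<open>z \<in> S\<close> by (simp add: strictly_convex_on_def)
    moreover have "(1 - t) *\<^sub>R z + t *\<^sub>R y = z + t *\<^sub>R (y - z)" by (simp add: algebra_simps)
    ultimately show ?thesis by (simp add: algebra_simps)
  qed
  interpret L: bounded_linear L using der by (rule has_derivative_bounded_linear)
  have weak: "f z + L (y - z) \<le> f y" if y: "y \<in> S" "y \<noteq> z" for y
  proof -
    let ?p = "\<lambda>t. z + t *\<^sub>R (y - z)"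
    have img: "?p ` {0..1} \<subseteq> S"
    proof
      fix w assume "w \<in> ?p ` {0..1}"
      then obtain t where "t \<in> {0..1}" "w = ?p t" by auto
      moreover have "?p t = (1 - t) *\<^sub>R z + t *\<^sub>R y" by (simp add: algebra_simps)
      ultimately show "w \<in> S" using convS y \<open>z \<in> S\<close> by (simp add: convexD)
    qed
    \<comment> \<open>The derivative of \<open>f\<close> is taken within \<open>S\<close>, so the
      segment is followed only for parameters in \<open>{0..1}\<close>, where it stays in
      \<open>S\<close>; the limit at 0 is one-sided.\<close>
    have "(?p has_derivative (\<lambda>t. t *\<^sub>R (y - z))) (at 0 within {0..1})"
      by (auto intro!: derivative_eq_intros)
    moreover have "(f has_derivative L) (at (?p 0) within ?p ` {0..1})"
      using der img by (auto intro: has_derivative_subset)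
    ultimately have "((\<lambda>t. f (?p t)) has_derivative (\<lambda>t. L (t *\<^sub>R (y - z)))) (at 0 within {0..1})"
      by (rule has_derivative_in_compose)
    then have "((\<lambda>t. f (?p t)) has_field_derivative L (y - z)) (at 0 within {0..1})"
      by (simp add: has_field_derivative_def L.scaleR mult_commute_abs)
    then have "((\<lambda>t. (f (?p t) - f z) / t) \<longlongrightarrow> L (y - z)) (at 0 within {0..1})"
      by (simp add: has_field_derivative_iff)
    moreover have "\<forall>\<^sub>F t in at (0::real) within {0..1}. (f (?p t) - f z) / t \<le> f y - f z"
      unfolding eventually_at
    proof (intro exI[of _ 1] conjI ballI impI)
      fix t :: real assume "t \<in> {0..1}" "t \<noteq> 0 \<and> dist t 0 < 1"
      then have "0 < t" "t < 1" by auto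
      then show "(f (?p t) - f z) / t \<le> f y - f z"
        using chord[OF y, of t] by (simp add: divide_le_eq mult.commute)
    qed simp
    ultimately have "L (y - z) \<le> f y - f z"
      by (rule tendsto_upperbound) (simp add: at_within_Icc_at_right trivial_limit_at_right_real)
    then show ?thesis by simp
  qed
  \<comment> \<open>At the midpoint the weak tangent bound from below meets the strict chord bound
    from above. Both are affine in \<open>L (b - z)\<close> and \<open>f b - f z\<close>, and
    halving cancels.\<close>
  let ?m = "z + (1 / 2) *\<^sub>R (b - z)"
  have "?m = (1 / 2) *\<^sub>R z + (1 / 2) *\<^sub>R b"
    by (simp add: algebra_simps flip: scaleR_left.add)
  then have "?m \<in> S" using convS assms(3,4) by (simp add: convexD)
  then have "f z + L (?m - z) \<le> f ?m" using \<open>b \<noteq> z\<close> by (intro weak) auto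
  moreover have "f ?m < f z + 1 / 2 * (f b - f z)" using assms by (intro chord) auto
  moreover have "L (?m - z) = 1 / 2 * L (b - z)" by (simp add: L.scaleR)
  ultimately show ?thesis by argo
qed

lemma transpose_add: "transpose (A + B) = transpose A + transpose (B :: 'a::plus ^ 'n ^ 'm)"
  by (simp add: transpose_def vec_eq_iff)

lemma matrix_add_rdistrib: "(A + B) ** C = A ** C + B ** (C :: 'a::semiring_1 ^ 'n ^ 'm)"
  by (vector matrix_matrix_mult_def sum.distrib[symmetric] distrib_right)

lemma subspace_sym_mats: "subspace sym_mats"
  by (auto simp: subspace_def sym_mats_def transpose_add transpose_scalar)
    (simp add: transpose_def vec_eq_iff)

lemma inner_transpose: "transpose A \<bullet> transpose B = A \<bullet> (B :: real ^ 'n ^ 'm)"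
  unfolding inner_vec_def transpose_def by (simp, rule sum.swap)

text \<open>Up to a transpose, the trace pairing is the Euclidean inner product of matrices, whose
  bilinearity rules then apply.\<close>

lemma frob_inner_transpose: "frob_inner A B = transpose A \<bullet> B"
  unfolding frob_inner_def trace_def matrix_matrix_mult_def inner_vec_def transpose_def
  by (simp, rule sum.swap)

lemma frob_inner_sym: "A \<in> sym_mats \<Longrightarrow> frob_inner A B = A \<bullet> B"
  by (simp add: frob_inner_transpose sym_mats_def)

text \<open>The Riesz representative of a derivative need not be symmetric, but its symmetric part
  pairs in the same way with symmetric directions, and differences of points of
  \<open>posdef\<close> are symmetric.\<close>

lemma has_derivative_sym_gradient_exists:
  fixes \<psi> :: "'n::finite sqmat \<Rightarrow> real"
  assumes "\<psi> differentiable (at X within posdef)" "X \<in> posdef"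
  obtains G where "G \<in> sym_mats" "(\<psi> has_derivative (\<lambda>H. frob_inner G H)) (at X within posdef)"
proof -
  obtain L where L: "(\<psi> has_derivative L) (at X within posdef)"
    using assms by (auto simp: differentiable_def)
  interpret L: bounded_linear L using L by (rule has_derivative_bounded_linear)
  define K where "K = (\<Sum>b\<in>Basis. L b *\<^sub>R b)"
  have K: "L H = K \<bullet> H" for H
  proof -
    have "L H = L (\<Sum>b\<in>Basis. (H \<bullet> b) *\<^sub>R b)" by (simp add: euclidean_representation)
    also have "\<dots> = (\<Sum>b\<in>Basis. (H \<bullet> b) * L b)" by (simp add: L.sum L.scaleR)
    also have "\<dots> = K \<bullet> H" by (simp add: K_def inner_sum_left inner_commute[of H] mult.commute)
    finally show ?thesis .
  qed
  define G where "G = (1 / 2) *\<^sub>R (K + transpose K)"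
  have G: "G \<in> sym_mats"
    by (simp add: G_def sym_mats_def transpose_add transpose_scalar transpose_transpose add.commute)
  have GL: "frob_inner G H = L H" if "H \<in> sym_mats" for H
  proof -
    have "transpose K \<bullet> H = K \<bullet> H"
      using inner_transpose[of K H] that by (simp add: sym_mats_def)
    then show ?thesis unfolding frob_inner_sym[OF G] K by (simp add: G_def inner_add_left)
  qed
  \<comment> \<open>\<open>L\<close> and \<open>frob_inner G\<close> may differ off
    \<open>sym_mats\<close>, so the exchange is made inside the difference quotient, which is
    evaluated only at symmetric increments \<open>y - X\<close>.\<close>
  have "((\<lambda>y. (1 / norm (y - X)) *\<^sub>R (\<psi> y - (\<psi> X + L (y - X)))) \<longlongrightarrow> 0) (at X within posdef)"
    using L by (simp add: has_derivative_within)
  moreover have "\<forall>\<^sub>F y in at X within posdef. L (y - X) = frob_inner G (y - X)"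
    unfolding eventually_at_topological
  proof (intro exI[of _ UNIV] conjI ballI impI)
    fix y :: "'n sqmat" assume "y \<in> posdef"
    then have "y - X \<in> sym_mats"
      using assms(2) by (intro subspace_diff[OF subspace_sym_mats]) (auto simp: posdef_def)
    then show "L (y - X) = frob_inner G (y - X)" using GL by simp
  qed auto
  ultimately have "((\<lambda>y. (1 / norm (y - X)) *\<^sub>R (\<psi> y - (\<psi> X + frob_inner G (y - X)))) \<longlongrightarrow> 0)
      (at X within posdef)"
    by (elim Lim_transform_eventually) (auto elim: eventually_mono)
  moreover have "bounded_linear (frob_inner G)"
    unfolding frob_inner_sym[OF G, abs_def] by (rule bounded_linear_inner_right)
  ultimately show ?thesis using G that by (simp add: has_derivative_within)
qed

text \<open>For matrices larger than 1 by 1, \<open>posdef\<close> has empty interior among all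
  matrices, so derivatives within it are not unique as linear maps. Restricting to the line through
  \<open>X\<close> in direction \<open>G - K\<close>, which is symmetric, reduces the question to
  one real variable.\<close>

lemma has_derivative_sym_gradient_unique:
  fixes \<psi> :: "'n::finite sqmat \<Rightarrow> real"
  assumes op: "openin (top_of_set sym_mats) (posdef :: 'n sqmat set)" and X: "X \<in> posdef"
    and G: "G \<in> sym_mats" "(\<psi> has_derivative (\<lambda>H. frob_inner G H)) (at X within posdef)"
    and K: "K \<in> sym_mats" "(\<psi> has_derivative (\<lambda>H. frob_inner K H)) (at X within posdef)"
  shows "G = K"
proof -
  define D where "D = G - K"
  have D: "D \<in> sym_mats" unfolding D_def using G K by (intro subspace_diff[OF subspace_sym_mats])
  obtain T :: "'n sqmat set" where T: "open T" "posdef = sym_mats \<inter> T"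
    using op unfolding openin_open by blast
  then have mem: "Z \<in> posdef \<longleftrightarrow> Z \<in> sym_mats \<and> Z \<in> T" for Z by blast
  let ?p = "\<lambda>t::real. X + t *\<^sub>R D"
  \<comment> \<open>\<open>U\<close> is an open set of parameters around 0 whose points on the line
    lie in \<open>posdef\<close>. Openness turns the derivative within \<open>U\<close> into a full
    derivative at 0, which is unique.\<close>
  define U where "U = ?p -` T"
  have "open U" unfolding U_def
    by (intro open_vimage T) (auto intro!: continuous_intros)
  have "0 \<in> U" using X by (simp add: U_def mem)
  have img: "?p ` U \<subseteq> posdef"
    using X D
    by (auto simp: U_def mem intro!: subspace_add[OF subspace_sym_mats] subspace_scale[OF subspace_sym_mats])
  have dir: "((\<lambda>t. \<psi> (?p t)) has_derivative (\<lambda>t. frob_inner A (t *\<^sub>R D))) (at 0)"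
    if "(\<psi> has_derivative (\<lambda>H. frob_inner A H)) (at X within posdef)" for A
  proof -
    have "(?p has_derivative (\<lambda>t. t *\<^sub>R D)) (at 0 within U)"
      by (auto intro!: derivative_eq_intros)
    moreover have "(\<psi> has_derivative (\<lambda>H. frob_inner A H)) (at (?p 0) within ?p ` U)"
      using has_derivative_subset[OF that img] by simp
    ultimately have "((\<lambda>t. \<psi> (?p t)) has_derivative (\<lambda>t. frob_inner A (t *\<^sub>R D))) (at 0 within U)"
      by (rule has_derivative_in_compose)
    then show ?thesis by (simp only: at_within_open[OF \<open>0 \<in> U\<close> \<open>open U\<close>])
  qed
  have "frob_inner G (1 *\<^sub>R D) = frob_inner K (1 *\<^sub>R D)"
    using fun_cong[OF has_derivative_unique[OF dir[OF G(2)] dir[OF K(2)]], of 1] .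
  then have "D \<bullet> D = 0" by (simp add: frob_inner_sym G K D_def inner_diff_left)
  then show ?thesis by (simp add: D_def)
qed

text \<open>Existence and uniqueness of a symmetric representative justify the definite description
  in \<open>gradient\<close>. Relative openness of \<open>posdef\<close> comes from the
  diffeomorphism clause.\<close>

lemma mirror_map_has_derivative_gradient:
  assumes "mirror_map \<psi>" "X \<in> posdef"
  shows "(\<psi> has_derivative (\<lambda>H. frob_inner (gradient \<psi> X) H)) (at X within posdef)"
proof -
  have op: "openin (top_of_set sym_mats) (posdef :: 'a sqmat set)"
    using assms by (simp add: mirror_map_def sym_diffeomorphism_def)
  obtain G where G: "G \<in> sym_mats" "(\<psi> has_derivative (\<lambda>H. frob_inner G H)) (at X within posdef)"
    using has_derivative_sym_gradient_exists[of \<psi> X] assms unfolding mirror_map_def by blast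
  have "gradient \<psi> X \<in> sym_mats \<and>
      (\<psi> has_derivative (\<lambda>H. frob_inner (gradient \<psi> X) H)) (at X within posdef)"
    unfolding gradient_def
    by (rule theI[of _ G]) (use G has_derivative_sym_gradient_unique[OF op assms(2)] in auto)
  then show ?thesis by blast
qed

lemma bregman_pos:
  assumes "mirror_map \<psi>" "B \<in> posdef" "Z \<in> posdef" "B \<noteq> Z"
  shows "0 < bregman \<psi> B Z"
  using strictly_convex_on_above_tangent[OF _ mirror_map_has_derivative_gradient[OF assms(1,3)] assms(3,2,4)]
    assms(1) by (simp add: mirror_map_def bregman_def)

text \<open>The displacements \<open>X - Z\<close> and \<open>Y - Z\<close> average to
  \<open>B - Z\<close>, while \<open>X - B\<close> and \<open>Y - B\<close> cancel. After adding and
  subtracting the value of \<open>\<psi>\<close> at \<open>B\<close>, the identity is linear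
  arithmetic.\<close>

lemma bregman_mean_decomposition:
  assumes "B = (1 / 2) *\<^sub>R (X + Y)"
  shows "1 / 2 * (bregman \<psi> X Z + bregman \<psi> Y Z) =
    1 / 2 * (bregman \<psi> X B + bregman \<psi> Y B) + bregman \<psi> B Z"
proof -
  define g h where "g = transpose (gradient \<psi> Z)" and "h = transpose (gradient \<psi> B)"
  have XY: "X + Y = 2 *\<^sub>R B" by (simp add: assms)
  have "g \<bullet> (X - Z) + g \<bullet> (Y - Z) = g \<bullet> ((X + Y) - 2 *\<^sub>R Z)"
    by (simp add: inner_add_right inner_diff_right)
  then have "g \<bullet> (X - Z) + g \<bullet> (Y - Z) = 2 * (g \<bullet> (B - Z))"
    unfolding XY by (simp add: inner_diff_right)
  moreover have "h \<bullet> (X - B) + h \<bullet> (Y - B) = h \<bullet> ((X + Y) - 2 *\<^sub>R B)"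
    by (simp add: inner_add_right inner_diff_right)
  then have "h \<bullet> (X - B) + h \<bullet> (Y - B) = 0" by (simp add: XY)
  ultimately show ?thesis
    unfolding bregman_def frob_inner_transpose g_def[symmetric] h_def[symmetric] by argo
qed

lemma posdef_midpoint:
  assumes "A \<in> posdef" "B \<in> posdef"
  shows "(1 / 2) *\<^sub>R (A + B) \<in> posdef"
proof -
  have "(1 / 2) *\<^sub>R (A + B) \<in> sym_mats"
    using assms by (intro subspace_scale subspace_add subspace_sym_mats) (auto simp: posdef_def)
  moreover have "0 < x \<bullet> ((1 / 2) *\<^sub>R (A + B) *v x)" if "x \<noteq> 0" for x
    using assms that
    by (simp add: posdef_def matrix_vector_mult_add_rdistrib inner_add_right add_pos_pos
        flip: scaleR_matrix_vector_assoc)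
  ultimately show ?thesis by (simp add: posdef_def)
qed

text \<open>Each order axiom for the arithmetic mean, both the bounds and the monotonicity, compares
  two matrices whose difference is half of a difference already known to be positive
  semidefinite.\<close>

lemma loewner_le_half:
  assumes "A \<preceq>\<^sub>L B" and "D - C = (1 / 2) *\<^sub>R (B - A)"
  shows "C \<preceq>\<^sub>L D"
  using assms subspace_scale[OF subspace_sym_mats, of "B - A" "1 / 2"]
  by (auto simp: loewner_le_def possemidef_def simp flip: scaleR_matrix_vector_assoc)

lemma arithmetic_mean_in_means:
  "(\<lambda>A B :: 'n::finite sqmat. (1 / 2) *\<^sub>R (A + B)) \<in> means"
  unfolding means_def mem_Collect_eq
proof (intro conjI ballI allI impI)
  fix A B :: "'n sqmat"
  assume AB: "A \<preceq>\<^sub>L B"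
  show "A \<preceq>\<^sub>L (1 / 2) *\<^sub>R (A + B)" "(1 / 2) *\<^sub>R (A + B) \<preceq>\<^sub>L B"
    by (rule loewner_le_half[OF AB], simp add: vec_eq_iff field_simps)+
next
  fix A B P :: "'n sqmat"
  show "(1 / 2) *\<^sub>R (transpose P ** A ** P + transpose P ** B ** P) =
      transpose P ** ((1 / 2) *\<^sub>R (A + B)) ** P"
    by (simp add: matrix_add_ldistrib matrix_add_rdistrib matrix_scalar_ac scaleR_add_right flip: scalar_matrix_assoc)
next
  show "continuous_on (posdef \<times> posdef) (\<lambda>(A, B :: 'n sqmat). (1 / 2) *\<^sub>R (A + B))"
    by (auto simp: split_def intro!: continuous_intros)
\<comment> \<open>Positive definiteness, symmetry and monotonicity remain; in the last, the fixed
  argument cancels from the difference.\<close>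
qed (auto simp: posdef_midpoint add.commute elim!: loewner_le_half simp flip: scaleR_diff_right)

theorem theorem1:
  fixes \<psi> :: "real ^ 'n ^ 'n \<Rightarrow> real" and X Y :: "real ^ 'n ^ 'n"
  assumes "mirror_map \<psi>" and "X \<in> posdef" and "Y \<in> posdef"
  shows "(\<exists>M. forward_minimizer \<psi> X Y M) \<and>
         (\<forall>M\<in>means. forward_minimizer \<psi> X Y M \<longleftrightarrow> M X Y = (1 / 2) *\<^sub>R (X + Y))"
proof -
  define B where "B = (1 / 2) *\<^sub>R (X + Y)"
  have B: "B \<in> posdef" unfolding B_def using assms by (intro posdef_midpoint)
  let ?A = "\<lambda>A B :: 'n sqmat. (1 / 2) *\<^sub>R (A + B)"
  let ?F = "forward_symm_bregman \<psi> X Y"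
  have A: "?A \<in> means" by (rule arithmetic_mean_in_means)
  have le: "?F ?A \<le> ?F M" and less: "M X Y \<noteq> B \<Longrightarrow> ?F ?A < ?F M"
    and eq: "M X Y = B \<Longrightarrow> ?F M = ?F ?A" if "M \<in> means" for M
  proof -
    have "M X Y \<in> posdef" using that assms by (simp add: means_def)
    moreover have "?F M = ?F ?A + bregman \<psi> B (M X Y)"
      using bregman_mean_decomposition[OF B_def, of \<psi> "M X Y"]
      by (simp add: forward_symm_bregman_def B_def)
    ultimately show "M X Y \<noteq> B \<Longrightarrow> ?F ?A < ?F M"
      using bregman_pos[OF assms(1) B] by auto
    show "M X Y = B \<Longrightarrow> ?F M = ?F ?A" by (simp add: forward_symm_bregman_def B_def)
    then show "?F ?A \<le> ?F M" using \<open>M X Y \<noteq> B \<Longrightarrow> ?F ?A < ?F M\<close> by fastforce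
  qed
  have "forward_minimizer \<psi> X Y M \<longleftrightarrow> M X Y = B" if "M \<in> means" for M
  proof
    assume "forward_minimizer \<psi> X Y M"
    \<comment> \<open>\<open>is_arg_min\<close> says that no admissible element is strictly smaller,
      so it is tested against the arithmetic mean.\<close>
    then have "\<not> ?F ?A < ?F M" using A by (simp add: forward_minimizer_def is_arg_min_def)
    then show "M X Y = B" using less[OF that] by blast
  next
    \<comment> \<open>\<open>M\<close> need not be the arithmetic mean as a function: the objective
      sees only its value at this pair.\<close>
    assume "M X Y = B"
    then have "\<not> ?F N < ?F M" if "N \<in> means" for N
      using eq[OF \<open>M \<in> means\<close>] le[OF that] by linarith
    then show "forward_minimizer \<psi> X Y M" using \<open>M \<in> means\<close>
      by (auto simp: forward_minimizer_def is_arg_min_def)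
  qed
  then show ?thesis using A by (auto simp: B_def)
qed

end
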